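(* Let $(X,d)$ be a complete metric space and let $u\in BC(\mathbb{R},X)$. The following statements are equivalent. (i) $u$ is periodic, i.e. there exists $\omega>0$ such that $u(t+\omega)=u(t)$ for all $t\in\mathbb{R}$. (ii) The set $\{T_\tau u : \tau\ge 0\}$ is a compact subset of $(BC(\mathbb{R},X),d_\infty)$. (iii) The set $\{R(T_\tau u) : \tau\in\mathbb{R}\}$ is a compact subset of $(BC(\mathbb{R}^+,X),d_{\infty,+})$.
   Context: $\mathbb{R}^+=[0,+\infty)$. For a metric space $(X,d)$ and $J=\mathbb{R}$ or $J=\mathbb{R}^+$, $BC(J,X)$ is the space of all bounded continuous functions from $J$ to $X$, with the metric $d_\infty(u,v)=\sup_{t\in\mathbb{R}}d(u(t),v(t))$ when $J=\mathbb{R}$, and $d_{\infty,+}(u,v)=\sup_{t\ge 0}d(u(t),v(t))$ when $J=\mathbb{R}^+$. For $\tau\in\mathbb{R}$ and $u\in BC(\mathbb{R},X)$, the translate $T_\tau u\in BC(\mathbb{R},X)$ is $T_\tau u(t)=u(t+\tau)$, $t\in\mathbb{R}$. The restriction operator $R:BC(\mathbb{R},X)\to BC(\mathbb{R}^+,X)$ is $R(u)(t)=u(t)$ for $t\ge 0$. *)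

theory Defs
  imports "HOL-Analysis.Analysis"
begin

text \<open>
  The space of bounded continuous functions from \<open>J\<close> to the metric space \<open>m\<close>, with the supremum
  metric. As always for \<open>cfunspace\<close>, its points are extensional: they take the value
  \<open>undefined\<close> outside \<open>J\<close> (no condition if \<open>J = UNIV\<close>), so that equality of points is equality
  on \<open>J\<close>.
\<close>

definition BC :: "real set \<Rightarrow> 'a metric \<Rightarrow> (real \<Rightarrow> 'a) metric" where
  "BC J m = cfunspace (top_of_set J) m"

definition translate :: "real \<Rightarrow> (real \<Rightarrow> 'a) \<Rightarrow> real \<Rightarrow> 'a" where
  "translate \<tau> u = (\<lambda>t. u (t + \<tau>))"

definition restrict_nonneg :: "(real \<Rightarrow> 'a) \<Rightarrow> real \<Rightarrow> 'a" where
  "restrict_nonneg u = restrict u {0..}"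

definition periodic :: "(real \<Rightarrow> 'a) \<Rightarrow> bool" where
  "periodic u \<longleftrightarrow> (\<exists>\<omega>>0. \<forall>t. u (t + \<omega>) = u t)"

lemma mspace_BC:
  "mspace (BC J m) =
     {f. f \<in> J \<rightarrow> mspace m \<and> f \<in> extensional J \<and>
         Metric_space.mbounded (mspace m) (mdist m) (f ` J) \<and>
         continuous_map (top_of_set J) (mtopology_of m) f}"
  by (simp add: BC_def)

lemma mdist_BC:
  assumes "J \<noteq> {}" "f \<in> mspace (BC J m)" "g \<in> mspace (BC J m)"
  shows "mdist (BC J m) f g = (SUP t\<in>J. mdist m (f t) (g t))"
  using assms cfunspace_subset_funspace[of "top_of_set J" m]
  by (auto simp: BC_def mdist_cfunspace_eq_mdist_funspace Metric_space.fdist_def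
      simp del: mspace_cfunspace)

lemma translate_in_BC:
  assumes "u \<in> mspace (BC UNIV m)"
  shows "translate \<tau> u \<in> mspace (BC UNIV m)"
proof -
  have "continuous_map euclideanreal euclideanreal (\<lambda>t. t + \<tau>)"
    by (simp add: continuous_map_iff_continuous2 continuous_intros)
  then have "continuous_map euclideanreal (mtopology_of m) (\<lambda>t. u (t + \<tau>))"
    using assms continuous_map_compose[of euclideanreal euclideanreal "\<lambda>t. t + \<tau>" "mtopology_of m" u]
    by (simp add: mspace_BC comp_def)
  moreover have "range (\<lambda>t. u (t + \<tau>)) = range u"
  proof -
    have "u t \<in> range (\<lambda>t. u (t + \<tau>))" for t
      by (rule image_eqI[of _ _ "t - \<tau>"]) simp_all
    then show ?thesis by auto
  qed
  ultimately show ?thesis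
    using assms by (auto simp: mspace_BC translate_def)
qed

lemma restrict_nonneg_in_BC:
  assumes "u \<in> mspace (BC UNIV m)"
  shows "restrict_nonneg u \<in> mspace (BC {0..} m)"
proof -
  have "continuous_map (top_of_set {0..}) (mtopology_of m) (restrict u {0..})"
    using assms by (intro continuous_map_eq[OF continuous_map_from_subtopology[of euclideanreal _ u]])
      (auto simp: mspace_BC)
  moreover have "Metric_space.mbounded (mspace m) (mdist m) (u ` {0..})"
    using assms Metric_space.mbounded_subset[OF Metric_space_mspace_mdist, of m "range u" "u ` {0..}"]
    by (auto simp: mspace_BC)
  ultimately show ?thesis
    using assms by (auto simp: mspace_BC restrict_nonneg_def)
qed

end

theory Submission
  imports Defs
begin

text \<open>
  Both sets in the theorem are sets of windows: for \<open>\<tau>\<close> in a closed set \<open>S\<close>, one looks at the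
  translate of \<open>u\<close> by \<open>\<tau>\<close> through the window \<open>J\<close>, with \<open>S = [0, \<infinity>)\<close>, \<open>J = \<real>\<close> in (ii) and
  \<open>S = \<real>\<close>, \<open>J = [0, \<infinity>)\<close> in (iii). Treating \<open>J\<close> and \<open>S\<close> as parameters lets the two cases share
  almost everything.

  If \<open>u\<close> has period \<open>\<omega>\<close>, it is uniformly continuous, so the window depends continuously on \<open>\<tau>\<close>,
  and the windows for \<open>\<tau> \<in> S\<close> are already those for \<open>\<tau> \<in> [0, \<omega>]\<close>: the set is a continuous image of
  a compact interval.

  Conversely, suppose that the set \<open>K\<close> of windows is compact. It is the union over \<open>n\<close> of the sets
  \<open>K\<^sub>n\<close> of windows with \<open>\<bar>\<tau>\<bar> \<le> n\<close>. Each \<open>K\<^sub>n\<close> is closed, for which the pointwise continuity of \<open>u\<close> is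
  enough. By Baire's theorem in the compact space \<open>K\<close>, some \<open>K\<^sub>n\<close> contains all windows of
  \<open>K\<close> that are close to a certain window, the one at \<open>\<sigma>\<close> (lemma \<open>compact_windows_Baire\<close>). On the
  other hand, compactness makes \<open>u\<close> recurrent: among the windows at multiples of a large number
  \<open>p\<close>, two are close to each other, and translating the comparison shows that the window at
  \<open>\<sigma> + \<tau>\<close> is close to the one at \<open>\<sigma>\<close>, where \<open>\<tau>\<close> is a nonzero multiple of \<open>p\<close>. So the window at
  \<open>\<sigma> + \<tau>\<close> equals a window at some \<open>s\<close> with \<open>\<bar>s\<bar> \<le> n\<close>, although \<open>\<bar>\<sigma> + \<tau>\<bar> > n\<close>.

  If \<open>J = \<real>\<close>, the difference \<open>\<sigma> + \<tau> - s\<close> is a period. If \<open>J = [0, \<infinity>)\<close>, it is only a period on the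
  half-line that starts at \<open>\<sigma> + \<tau>\<close>, but this starting point can be chosen as far to the left as
  desired. The periods on these half-lines may differ, yet the period found on one of them works
  everywhere (lemma \<open>periodic_if_periodic_on_half_lines\<close>).
\<close>

section \<open>Windows\<close>

definition window :: "real set \<Rightarrow> (real \<Rightarrow> 'a) \<Rightarrow> real \<Rightarrow> real \<Rightarrow> 'a" where
  "window J u \<tau> = restrict (translate \<tau> u) J"

lemma window_apply [simp]: "t \<in> J \<Longrightarrow> window J u \<tau> t = u (t + \<tau>)"
  by (simp add: window_def translate_def)

lemma window_eqI: "(\<And>t. t \<in> J \<Longrightarrow> u (t + a) = u (t + b)) \<Longrightarrow> window J u a = window J u b"
  by (auto simp: window_def translate_def restrict_def)

lemma window_UNIV: "window UNIV u \<tau> = translate \<tau> u"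
  by (auto simp: window_def)

lemma window_in_BC:
  assumes "u \<in> mspace (BC UNIV X)"
  shows "window J u \<tau> \<in> mspace (BC J X)"
proof -
  let ?v = "translate \<tau> u"
  have v: "?v \<in> mspace (BC UNIV X)"
    using assms by (rule translate_in_BC)
  have "continuous_map (top_of_set J) (mtopology_of X) (restrict ?v J)"
    using v by (intro continuous_map_eq[OF continuous_map_from_subtopology[of euclideanreal _ ?v]])
      (auto simp: mspace_BC)
  moreover have "Metric_space.mbounded (mspace X) (mdist X) (?v ` J)"
    using v Metric_space.mbounded_subset[OF Metric_space_mspace_mdist, of X "range ?v" "?v ` J"]
    by (auto simp: mspace_BC)
  ultimately show ?thesis
    using v by (auto simp: mspace_BC window_def)
qed

lemma mdist_BC_ge_pointwise:
  assumes "f \<in> mspace (BC J X)" "g \<in> mspace (BC J X)" "t \<in> J"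
  shows "mdist X (f t) (g t) \<le> mdist (BC J X) f g"
  using mdist_cfunspace_imp_mdist_le[of f "top_of_set J" X g _ t] assms by (auto simp: BC_def)

lemma mdist_BC_le:
  assumes "0 \<le> B" "\<And>t. t \<in> J \<Longrightarrow> mdist X (f t) (g t) \<le> B"
  shows "mdist (BC J X) f g \<le> B"
  using mdist_cfunspace_le[of B "top_of_set J" X f g] assms by (simp add: BC_def)

lemma limitin_BC_pointwise:
  assumes "limitin (mtopology_of (BC J X)) f l sequentially"
    and f: "\<And>n. f n \<in> mspace (BC J X)" and "t \<in> J"
  shows "limitin (mtopology_of X) (\<lambda>n. f n t) (l t) sequentially"
proof -
  interpret B: Metric_space "mspace (BC J X)" "mdist (BC J X)" by simp
  interpret X: Metric_space "mspace X" "mdist X" by simp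
  have l: "l \<in> mspace (BC J X)"
    and lim: "(\<lambda>n. mdist (BC J X) (f n) l) \<longlonglongrightarrow> 0"
    using assms(1) by (auto simp: mtopology_of_def B.limitin_metric_dist_null)
  have mem: "g t \<in> mspace X" if "g \<in> mspace (BC J X)" for g
    using that \<open>t \<in> J\<close> by (auto simp: mspace_BC)
  have "(\<lambda>n. mdist X (f n t) (l t)) \<longlonglongrightarrow> 0"
    by (rule real_tendsto_sandwich[OF _ _ tendsto_const lim])
      (auto simp: mdist_BC_ge_pointwise f l \<open>t \<in> J\<close>)
  then show ?thesis
    using mem f l by (simp add: mtopology_of_def X.limitin_metric_dist_null)
qed

section \<open>Periodic functions have compact sets of windows\<close>

lemma period_multiple:
  fixes u :: "real \<Rightarrow> 'a"
  assumes "\<And>t. u (t + \<omega>) = u t"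
  shows "u (t + of_int k * \<omega>) = u t"
proof -
  interpret periodic_fun_simple u \<omega> by standard (rule assms)
  show ?thesis by (rule plus_of_int)
qed

lemma translate_into_period:
  fixes x \<omega> :: real
  assumes "\<omega> > 0"
  obtains k :: int where "x + of_int k * \<omega> \<in> {0..\<omega>}"
  using floor_divide_lower[OF assms, of x] floor_divide_upper[OF assms, of x]
  by (intro that[of "- \<lfloor>x / \<omega>\<rfloor>"]) (auto simp: algebra_simps)

text \<open>
  Translating by a multiple of the period moves \<open>x\<close> into \<open>[0, \<omega>]\<close>; a point at distance less than
  \<open>\<omega>\<close> from it then lies in the compact interval \<open>[-\<omega>, 2\<omega>]\<close>, on which continuity is uniform.
\<close>
lemma periodic_imp_uniformly_continuous:
  fixes u :: "real \<Rightarrow> 'a"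
  assumes u: "u \<in> mspace (BC UNIV X)"
    and "\<omega> > 0" and per: "\<And>t. u (t + \<omega>) = u t" and "\<epsilon> > 0"
  obtains \<delta> where "\<delta> > 0" "\<And>x y. \<bar>x - y\<bar> < \<delta> \<Longrightarrow> mdist X (u x) (u y) < \<epsilon>"
proof -
  let ?I = "{-\<omega>..2*\<omega>}"
  let ?m = "submetric euclidean_metric ?I"
  have top: "mtopology_of ?m = top_of_set ?I"
    by (simp add: mtopology_of_submetric)
  have "continuous_map (top_of_set ?I) (mtopology_of X) u"
    using u by (intro continuous_map_from_subtopology) (simp add: mspace_BC)
  moreover have "compact_space (top_of_set ?I)"
    by (simp add: compact_space_subtopology)
  ultimately have "uniformly_continuous_map ?m X u"
    using continuous_eq_uniformly_continuous_map[of ?m X u] top by simp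
  then obtain \<delta> where "\<delta> > 0"
    and \<delta>: "\<And>x y. x \<in> ?I \<Longrightarrow> y \<in> ?I \<Longrightarrow> dist y x < \<delta> \<Longrightarrow> mdist X (u y) (u x) < \<epsilon>"
    using \<open>\<epsilon> > 0\<close> unfolding uniformly_continuous_map_def by (auto; metis)
  show thesis
  proof
    show "min \<delta> \<omega> > 0"
      using \<open>\<delta> > 0\<close> \<open>\<omega> > 0\<close> by simp
    fix x y assume xy: "\<bar>x - y\<bar> < min \<delta> \<omega>"
    obtain k :: int where "x + of_int k * \<omega> \<in> {0..\<omega>}"
      using translate_into_period[OF \<open>\<omega> > 0\<close>] .
    then have "mdist X (u (x + of_int k * \<omega>)) (u (y + of_int k * \<omega>)) < \<epsilon>"
      using xy by (intro \<delta>) (auto simp: dist_real_def)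
    then show "mdist X (u x) (u y) < \<epsilon>"
      by (simp add: period_multiple per)
  qed
qed

lemma periodic_imp_compact_windows:
  assumes u: "u \<in> mspace (BC UNIV X)" and "periodic u" and "{0..} \<subseteq> S"
  shows "compactin (mtopology_of (BC J X)) (window J u ` S)"
proof -
  obtain \<omega> where "\<omega> > 0" and per: "\<And>t. u (t + \<omega>) = u t"
    using \<open>periodic u\<close> by (auto simp: periodic_def)
  have "uniformly_continuous_map euclidean_metric (BC J X) (window J u)"
    unfolding uniformly_continuous_map_def
  proof (intro conjI allI impI)
    show "window J u \<in> mspace euclidean_metric \<rightarrow> mspace (BC J X)"
      by (simp add: window_in_BC[OF u])
    fix \<epsilon> :: real assume "\<epsilon> > 0"
    then obtain \<delta> where "\<delta> > 0"
      and \<delta>: "\<And>x y. \<bar>x - y\<bar> < \<delta> \<Longrightarrow> mdist X (u x) (u y) < \<epsilon> / 2"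
      using periodic_imp_uniformly_continuous[OF u \<open>\<omega> > 0\<close> per, of "\<epsilon> / 2"] by auto
    have "mdist (BC J X) (window J u b) (window J u a) < \<epsilon>" if "dist b a < \<delta>" for a b
    proof -
      have "mdist (BC J X) (window J u b) (window J u a) \<le> \<epsilon> / 2"
        using that \<open>\<epsilon> > 0\<close> \<delta>[of "t + b" "t + a" for t]
        by (intro mdist_BC_le) (simp_all add: dist_real_def less_imp_le)
      then show ?thesis using \<open>\<epsilon> > 0\<close> by simp
    qed
    then show "\<exists>\<delta>>0. \<forall>x\<in>mspace euclidean_metric. \<forall>y\<in>mspace euclidean_metric.
        mdist euclidean_metric y x < \<delta> \<longrightarrow> mdist (BC J X) (window J u y) (window J u x) < \<epsilon>"
      using \<open>\<delta> > 0\<close> by auto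
  qed
  then have "continuous_map euclideanreal (mtopology_of (BC J X)) (window J u)"
    using uniformly_continuous_imp_continuous_map by fastforce
  then have "compactin (mtopology_of (BC J X)) (window J u ` {0..\<omega>})"
    by (rule image_compactin[rotated]) simp
  moreover have "window J u ` S = window J u ` {0..\<omega>}"
  proof
    show "window J u ` {0..\<omega>} \<subseteq> window J u ` S"
      using \<open>{0..} \<subseteq> S\<close> by auto
    show "window J u ` S \<subseteq> window J u ` {0..\<omega>}"
    proof
      fix f assume "f \<in> window J u ` S"
      then obtain \<tau> where f: "f = window J u \<tau>" by auto
      obtain k :: int where "\<tau> + of_int k * \<omega> \<in> {0..\<omega>}"
        using translate_into_period[OF \<open>\<omega> > 0\<close>] .
      moreover have "f = window J u (\<tau> + of_int k * \<omega>)"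
        unfolding f using period_multiple[of u \<omega>, OF per]
        by (intro window_eqI) (metis add.assoc)
      ultimately show "f \<in> window J u ` {0..\<omega>}" by blast
    qed
  qed
  ultimately show ?thesis by simp
qed

section \<open>Consequences of compactness\<close>

text \<open>
  A limit of windows at times \<open>s\<^sub>k\<close> is a window at any limit point of the \<open>s\<^sub>k\<close>, because \<open>u\<close> is
  continuous and uniform limits are pointwise limits. Since \<open>u\<close> may fail to be uniformly
  continuous, the set cannot be treated as a continuous image of \<open>A\<close>.
\<close>
lemma closedin_windows:
  assumes u: "u \<in> mspace (BC UNIV X)" and "compact A"
  shows "closedin (mtopology_of (BC J X)) (window J u ` A)"
proof -
  interpret B: Metric_space "mspace (BC J X)" "mdist (BC J X)" by simp
  interpret X: Metric_space "mspace X" "mdist X" by simp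
  have "l \<in> window J u ` A"
    if rng: "range f \<subseteq> window J u ` A" and lim: "limitin B.mtopology f l sequentially" for f l
  proof -
    have l: "l \<in> mspace (BC J X)"
      using lim B.limitin_mspace by blast
    have "\<forall>n. \<exists>s\<in>A. f n = window J u s"
      using rng by blast
    then obtain s where s: "\<And>n. s n \<in> A" "\<And>n. f n = window J u (s n)"
      by metis
    obtain a r where "a \<in> A" and r: "strict_mono r" and sr: "(s \<circ> r) \<longlonglongrightarrow> a"
      using \<open>compact A\<close> s(1) unfolding compact_def by blast
    have lim_r: "limitin (mtopology_of (BC J X)) (f \<circ> r) l sequentially"
      using limitin_subsequence[OF r lim] by (simp add: mtopology_of_def)
    have "l t = u (t + a)" if "t \<in> J" for t
    proof (rule X.limitin_metric_unique)
      show "limitin X.mtopology (\<lambda>n. (f \<circ> r) n t) (l t) sequentially"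
        using limitin_BC_pointwise[OF lim_r _ that] s(2) window_in_BC[OF u]
        by (simp add: mtopology_of_def)
      have "limitin euclideanreal (\<lambda>n. t + (s \<circ> r) n) (t + a) sequentially"
        using tendsto_add[OF tendsto_const sr] by (simp only: limitin_canonical_iff)
      moreover have "continuous_map euclideanreal X.mtopology u"
        using u by (simp add: mspace_BC mtopology_of_def)
      ultimately have "limitin X.mtopology (u \<circ> (\<lambda>n. t + (s \<circ> r) n)) (u (t + a)) sequentially"
        by (rule continuous_map_limit[rotated])
      then show "limitin X.mtopology (\<lambda>n. (f \<circ> r) n t) (u (t + a)) sequentially"
        using s(2) that by (simp add: o_def)
    qed simp
    moreover have "l \<in> extensional J"
      using l by (simp add: mspace_BC)
    ultimately have "l = window J u a"
      by (auto simp: window_def translate_def restrict_def extensional_def)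
    with \<open>a \<in> A\<close> show ?thesis by blast
  qed
  then show ?thesis
    using window_in_BC[OF u] unfolding mtopology_of_def B.metric_closedin_iff_sequentially_closed
    by blast
qed

lemma compact_windows_Baire:
  assumes u: "u \<in> mspace (BC UNIV X)" and "closed S" "S \<noteq> {}"
    and K: "compactin (mtopology_of (BC J X)) (window J u ` S)"
  obtains \<sigma> \<epsilon> n where "\<sigma> \<in> S" "\<epsilon> > 0"
    "\<And>\<tau>. \<tau> \<in> S \<Longrightarrow> mdist (BC J X) (window J u \<sigma>) (window J u \<tau>) < \<epsilon> \<Longrightarrow>
        \<exists>s. \<bar>s\<bar> \<le> real n \<and> window J u \<tau> = window J u s"
proof -
  interpret B: Metric_space "mspace (BC J X)" "mdist (BC J X)" by simp
  let ?K = "window J u ` S"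
  let ?T = "subtopology B.mtopology ?K"
  define C where "C = (\<lambda>n::nat. window J u ` (S \<inter> {-real n..real n}))"
  have Kc: "compactin B.mtopology ?K"
    using K by (simp add: mtopology_of_def)
  have Ksub: "?K \<subseteq> mspace (BC J X)"
    using window_in_BC[OF u] by blast
  then have topT: "topspace ?T = ?K"
    by auto
  have closed: "closedin ?T (C n)" for n
  proof -
    have "closedin B.mtopology (C n)"
      using closedin_windows[OF u, of "S \<inter> {-real n..real n}" J] \<open>closed S\<close>
      by (simp add: C_def mtopology_of_def closed_Int_compact)
    then show ?thesis
      by (rule closedin_subset_topspace) (auto simp: C_def)
  qed
  have "\<tau> \<in> (\<Union>n. S \<inter> {-real n..real n})" if "\<tau> \<in> S" for \<tau>
    using that real_arch_simple[of "\<bar>\<tau>\<bar>"] by (auto simp: abs_le_iff minus_le_iff)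
  then have union: "\<Union> (range C) = ?K"
    unfolding C_def by blast
  have "compact_space ?T"
    using Kc by (rule compact_space_subtopology)
  moreover have "Hausdorff_space ?T"
    by (intro Hausdorff_space_subtopology B.Hausdorff_space_mtopology)
  ultimately have T: "locally_compact_space ?T \<and> regular_space ?T"
    by (simp add: compact_imp_locally_compact_space compact_Hausdorff_imp_regular_space)
  have "?T interior_of \<Union> (range C) \<noteq> {}"
    using \<open>S \<noteq> {}\<close> interior_of_topspace[of ?T] unfolding union topT by simp
  then obtain n where "?T interior_of C n \<noteq> {}"
    using Baire_category_alt[of ?T "range C"] T closed by auto
  then obtain f where "f \<in> ?T interior_of C n" by blast
  then obtain W where "openin B.mtopology W" "f \<in> W" "f \<in> ?K" and W: "W \<inter> ?K \<subseteq> C n"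
    by (auto simp: interior_of_def openin_subtopology)
  then obtain \<epsilon> \<sigma> where "\<epsilon> > 0" and \<epsilon>: "B.mball f \<epsilon> \<subseteq> W" and \<sigma>: "\<sigma> \<in> S" "f = window J u \<sigma>"
    by (auto simp: B.openin_mtopology)
  show thesis
  proof
    show "\<sigma> \<in> S" "\<epsilon> > 0" by fact+
    fix \<tau>
    assume "\<tau> \<in> S" "mdist (BC J X) (window J u \<sigma>) (window J u \<tau>) < \<epsilon>"
    then have "window J u \<tau> \<in> B.mball f \<epsilon>" "window J u \<tau> \<in> ?K"
      using \<sigma> window_in_BC[OF u] by (auto simp: B.in_mball)
    then have "window J u \<tau> \<in> C n"
      using \<epsilon> W by blast
    then show "\<exists>s. \<bar>s\<bar> \<le> real n \<and> window J u \<tau> = window J u s"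
      by (force simp: C_def)
  qed
qed

lemma compact_windows_recurrent:
  fixes \<theta> :: "nat \<Rightarrow> real"
  assumes K: "compactin (mtopology_of (BC J X)) (window J u ` S)"
    and \<theta>: "\<And>k. \<theta> k \<in> S" and "\<epsilon> > 0"
  obtains k l where "k < l" "mdist (BC J X) (window J u (\<theta> k)) (window J u (\<theta> l)) < \<epsilon>"
proof -
  interpret B: Metric_space "mspace (BC J X)" "mdist (BC J X)" by simp
  have Ksub: "window J u ` S \<subseteq> mspace (BC J X)"
    using compactin_subset_topspace[OF K] by simp
  have "range (\<lambda>k. window J u (\<theta> k)) \<subseteq> window J u ` S"
    using \<theta> by blast
  then obtain f r where r: "strict_mono r"
    and lim: "limitin B.mtopology ((\<lambda>k. window J u (\<theta> k)) \<circ> r) f sequentially"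
    using K unfolding mtopology_of_def B.compactin_sequentially by blast
  have "B.MCauchy ((\<lambda>k. window J u (\<theta> k)) \<circ> r)"
    using B.convergent_imp_MCauchy[OF _ lim] Ksub \<theta> by auto
  then obtain N where "mdist (BC J X) (window J u (\<theta> (r N))) (window J u (\<theta> (r (Suc N)))) < \<epsilon>"
    unfolding B.MCauchy_def using \<open>\<epsilon> > 0\<close> by (metis comp_apply le_Suc_eq order_refl)
  with strict_monoD[OF r, of N "Suc N"] show thesis
    by (intro that[of "r N" "r (Suc N)"]) auto
qed

section \<open>Compact sets of windows force periodicity\<close>

text \<open>
  The distance of two windows on the whole line is invariant under translation, so a close pair of
  windows at multiples of \<open>p\<close> can be moved to \<open>\<sigma>\<close> directly.
\<close>
lemma compact_forward_windows_imp_periodic: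
  assumes u: "u \<in> mspace (BC UNIV X)"
    and K: "compactin (mtopology_of (BC UNIV X)) (window UNIV u ` {0..})"
  shows "periodic u"
proof -
  obtain \<sigma> \<epsilon> n where "\<sigma> \<ge> 0" "\<epsilon> > 0"
    and near: "\<And>\<tau>. \<tau> \<in> {0..} \<Longrightarrow> mdist (BC UNIV X) (window UNIV u \<sigma>) (window UNIV u \<tau>) < \<epsilon> \<Longrightarrow>
        \<exists>s. \<bar>s\<bar> \<le> real n \<and> window UNIV u \<tau> = window UNIV u s"
    using compact_windows_Baire[OF u _ _ K] by (metis atLeast_iff closed_atLeast empty_iff order_refl)
  define p where "p = real n + 1"
  obtain k l :: nat where "k < l"
    and kl: "mdist (BC UNIV X) (window UNIV u (real k * p)) (window UNIV u (real l * p)) < \<epsilon>"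
    using compact_windows_recurrent[OF K, of "\<lambda>k. real k * p"] \<open>\<epsilon> > 0\<close> by (auto simp: p_def)
  define \<tau> where "\<tau> = real (l - k) * p"
  have \<tau>_eq: "\<tau> = real l * p - real k * p"
    using \<open>k < l\<close> by (simp add: \<tau>_def of_nat_diff algebra_simps)
  have "1 * p \<le> \<tau>"
    unfolding \<tau>_def using \<open>k < l\<close> by (intro mult_right_mono) (auto simp: p_def)
  then have "\<tau> > real n" by (simp add: p_def)
  have "mdist (BC UNIV X) (window UNIV u \<sigma>) (window UNIV u (\<sigma> + \<tau>))
      \<le> mdist (BC UNIV X) (window UNIV u (real k * p)) (window UNIV u (real l * p))"
  proof (rule mdist_BC_le)
    fix t :: real
    show "mdist X (window UNIV u \<sigma> t) (window UNIV u (\<sigma> + \<tau>) t)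
        \<le> mdist (BC UNIV X) (window UNIV u (real k * p)) (window UNIV u (real l * p))"
      using mdist_BC_ge_pointwise[OF window_in_BC[OF u] window_in_BC[OF u],
          of "t + \<sigma> - real k * p" UNIV "real k * p" "real l * p"]
      by (simp add: \<tau>_eq algebra_simps)
  qed simp
  then obtain s where s: "\<bar>s\<bar> \<le> real n" "window UNIV u (\<sigma> + \<tau>) = window UNIV u s"
    using near[of "\<sigma> + \<tau>"] kl \<open>\<sigma> \<ge> 0\<close> \<open>\<tau> > real n\<close> by auto
  have "u (t + (\<sigma> + \<tau> - s)) = u t" for t
    using fun_cong[OF s(2), of "t - s"] by (simp add: algebra_simps)
  moreover have "\<sigma> + \<tau> - s > 0"
    using s(1) \<open>\<sigma> \<ge> 0\<close> \<open>\<tau> > real n\<close> by linarith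
  ultimately show ?thesis
    unfolding periodic_def by blast
qed

text \<open>
  Let \<open>\<omega>\<close> be the period on one half-line \<open>[b, \<infinity>)\<close>. For a point \<open>x\<close> to the left of \<open>b\<close>, use
  a period \<open>\<omega>'\<close> that is valid from \<open>x\<close> on: adding a large multiple of \<open>\<omega>'\<close> moves both \<open>x\<close>
  and \<open>x + \<omega>\<close> into \<open>[b, \<infinity>)\<close> and changes neither value.
\<close>
lemma periodic_if_periodic_on_half_lines:
  fixes u :: "real \<Rightarrow> 'a"
  assumes ex: "\<And>a. \<exists>b\<le>a. \<exists>\<omega>>0. \<forall>x\<ge>b. u (x + \<omega>) = u x"
  shows "periodic u"
proof -
  obtain b \<omega> where "\<omega> > 0" and \<omega>: "\<And>x. x \<ge> b \<Longrightarrow> u (x + \<omega>) = u x"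
    using ex[of 0] by blast
  have "u (x + \<omega>) = u x" for x
  proof -
    obtain c \<omega>' where "c \<le> x" "\<omega>' > 0" and \<omega>': "\<And>y. y \<ge> c \<Longrightarrow> u (y + \<omega>') = u y"
      using ex[of x] by blast
    have shift: "u (y + real m * \<omega>') = u y" if "y \<ge> c" for y m
    proof (induction m)
      case (Suc m)
      have "u (y + real (Suc m) * \<omega>') = u ((y + real m * \<omega>') + \<omega>')"
        by (simp add: algebra_simps)
      also have "\<dots> = u (y + real m * \<omega>')"
        using that \<open>\<omega>' > 0\<close> by (intro \<omega>') (simp add: add_increasing2)
      finally show ?case using Suc.IH by simp
    qed simp
    obtain m where "b - x < real m * \<omega>'"
      using reals_Archimedean3[OF \<open>\<omega>' > 0\<close>] by blast
    then have "u (x + real m * \<omega>' + \<omega>) = u (x + real m * \<omega>')"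
      by (intro \<omega>) simp
    then show ?thesis
      using shift[of x m] shift[of "x + \<omega>" m] \<open>c \<le> x\<close> \<open>\<omega> > 0\<close> by (simp add: algebra_simps)
  qed
  with \<open>\<omega> > 0\<close> show ?thesis
    by (auto simp: periodic_def)
qed

text \<open>
  On half-lines, the distance of two windows only controls the distance of windows further to the
  right. Therefore the close pair is sought to the left of \<open>\<sigma>\<close>. Going left also makes the
  half-line on which \<open>u\<close> turns out to be periodic start before any given \<open>a\<close>.
\<close>
lemma compact_half_line_windows_imp_periodic:
  assumes u: "u \<in> mspace (BC UNIV X)"
    and K: "compactin (mtopology_of (BC {0..} X)) (window {0..} u ` UNIV)"
  shows "periodic u"
proof (rule periodic_if_periodic_on_half_lines)
  fix a :: real
  let ?w = "window {0..} u"
  obtain \<sigma> \<epsilon> n where "\<epsilon> > 0"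
    and near: "\<And>\<tau>. mdist (BC {0..} X) (?w \<sigma>) (?w \<tau>) < \<epsilon> \<Longrightarrow>
        \<exists>s. \<bar>s\<bar> \<le> real n \<and> ?w \<tau> = ?w s"
    using compact_windows_Baire[OF u _ _ K] by (metis UNIV_I UNIV_not_empty closed_UNIV)
  \<comment> \<open>This choice gives \<open>\<sigma> - p < - n\<close>, \<open>\<sigma> - p \<le> a\<close> and \<open>- p \<le> \<sigma>\<close>.\<close>
  define p where "p = real n + \<bar>\<sigma>\<bar> + \<bar>a\<bar> + 1"
  have "p > 0" by (simp add: p_def)
  obtain k l :: nat where "k < l"
    and kl: "mdist (BC {0..} X) (?w (- real (Suc k) * p)) (?w (- real (Suc l) * p)) < \<epsilon>"
    using compact_windows_recurrent[OF K, of "\<lambda>k. - real (Suc k) * p"] \<open>\<epsilon> > 0\<close> by blast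
  define \<tau> where "\<tau> = - (real (l - k) * p)"
  have \<tau>_eq: "\<tau> = real (Suc k) * p - real (Suc l) * p"
    using \<open>k < l\<close> by (simp add: \<tau>_def of_nat_diff algebra_simps)
  have "1 * p \<le> real (l - k) * p" "1 * p \<le> real (Suc k) * p"
    using \<open>k < l\<close> \<open>p > 0\<close> by (intro mult_right_mono; simp)+
  moreover have "\<bar>\<sigma>\<bar> \<le> p" by (simp add: p_def)
  ultimately have \<tau>: "\<tau> \<le> - p" and \<sigma>: "0 \<le> \<sigma> + real (Suc k) * p"
    unfolding \<tau>_def by linarith+
  have "mdist (BC {0..} X) (?w \<sigma>) (?w (\<sigma> + \<tau>))
      \<le> mdist (BC {0..} X) (?w (- real (Suc k) * p)) (?w (- real (Suc l) * p))"
  proof (rule mdist_BC_le)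
    fix t :: real assume "t \<in> {0..}"
    then have *: "t + \<sigma> + real (Suc k) * p \<in> {0..}"
      using \<sigma> by simp
    show "mdist X (?w \<sigma> t) (?w (\<sigma> + \<tau>) t)
        \<le> mdist (BC {0..} X) (?w (- real (Suc k) * p)) (?w (- real (Suc l) * p))"
      using mdist_BC_ge_pointwise[OF window_in_BC[OF u] window_in_BC[OF u] *,
          of "- real (Suc k) * p" "- real (Suc l) * p"] * \<open>t \<in> {0..}\<close>
      by (simp add: \<tau>_eq algebra_simps)
  qed simp
  then obtain s where s: "\<bar>s\<bar> \<le> real n" "?w (\<sigma> + \<tau>) = ?w s"
    using near[of "\<sigma> + \<tau>"] kl by auto
  have "u (x + (s - (\<sigma> + \<tau>))) = u x" if "x \<ge> \<sigma> + \<tau>" for x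
    using fun_cong[OF s(2), of "x - (\<sigma> + \<tau>)"] that by (simp add: algebra_simps)
  moreover have "s - (\<sigma> + \<tau>) > 0" "\<sigma> + \<tau> \<le> a"
    using s(1) \<tau> by (auto simp: p_def)
  ultimately show "\<exists>b\<le>a. \<exists>\<omega>>0. \<forall>x\<ge>b. u (x + \<omega>) = u x"
    by blast
qed

section \<open>The equivalence\<close>

theorem corollary5p1:
  fixes X :: "'a metric" and u :: "real \<Rightarrow> 'a"
  assumes "mcomplete_of X"
    and "u \<in> mspace (BC UNIV X)"
  shows "(periodic u \<longleftrightarrow>
            compactin (mtopology_of (BC UNIV X)) {translate \<tau> u | \<tau>. \<tau> \<ge> 0})
       \<and> (compactin (mtopology_of (BC UNIV X)) {translate \<tau> u | \<tau>. \<tau> \<ge> 0} \<longleftrightarrow>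
            compactin (mtopology_of (BC {0..} X)) {restrict_nonneg (translate \<tau> u) | \<tau>. \<tau> \<in> UNIV})"
proof -
  have ii: "{translate \<tau> u | \<tau>. \<tau> \<ge> 0} = window UNIV u ` {0..}"
    by (auto simp: window_UNIV)
  have iii: "{restrict_nonneg (translate \<tau> u) | \<tau>. \<tau> \<in> UNIV} = window {0..} u ` UNIV"
    by (auto simp: window_def restrict_nonneg_def)
  show ?thesis
    unfolding ii iii
    using assms(2) periodic_imp_compact_windows[of u X "{0..}" UNIV]
      periodic_imp_compact_windows[of u X UNIV "{0..}"]
      compact_forward_windows_imp_periodic[of u X] compact_half_line_windows_imp_periodic[of u X]
    by blast
qed

end
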